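(* Let $I\times_f\mathbb{S}^n$ be a spherical Robertson-Walker spacetime which is expanding ($f'(s)>0$ for all $s\in I$) or contracting ($f'(s)<0$ for all $s\in I$) and which satisfies the Null Convergence Condition. Then there is no stationary compact spacelike submanifold in $I\times_f\mathbb{S}^n$.
   Context: A spherical Robertson-Walker (RW) spacetime $I\times_f\mathbb{S}^n$ is the product manifold $I\times\mathbb{S}^n$, with $I\subset\mathbb{R}$ an open interval and $\mathbb{S}^n$ the unit round $n$-sphere with metric $g$, endowed with the Lorentzian metric $-ds^2+f(s)^2g$, where $f\in C^\infty(I)$ is positive. A Lorentzian manifold satisfies the Null Convergence Condition if its Ricci tensor satisfies $\overline{\mathrm{Ric}}(X,X)\ge 0$ for every null tangent vector $X$. A spacelike submanifold is an immersed submanifold $M^k$ (of dimension $k\ge1$) whose induced metric is Riemannian; compact means compact without boundary. It is stationary if its mean curvature vector field (the normalized trace of its second fundamental form) vanishes identically. *)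

theory Defs
  imports "HOL-Analysis.Analysis"
begin

section \<open>Smooth functions and smooth manifolds\<close>

text \<open>The class C^k, defined through iterated directional derivatives.  It is only applied to
  open sets \<open>S\<close>.\<close>

fun ck_on :: "nat \<Rightarrow> 'a::real_normed_vector set \<Rightarrow> ('a \<Rightarrow> 'b::real_normed_vector) \<Rightarrow> bool" where
  "ck_on 0 S f \<longleftrightarrow> continuous_on S f"
| "ck_on (Suc k) S f \<longleftrightarrow>
     (\<forall>x\<in>S. f differentiable (at x)) \<and>
     (\<forall>v. ck_on k S (\<lambda>x. frechet_derivative f (at x) v))"

definition smooth_on :: "'a::real_normed_vector set \<Rightarrow> ('a \<Rightarrow> 'b::real_normed_vector) \<Rightarrow> bool" where
  "smooth_on S f \<longleftrightarrow> (\<forall>k. ck_on k S f)"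

text \<open>A chart is its domain together with the coordinate map; the dimension is the
  cardinality of the index type.\<close>

type_synonym ('p, 'k) chart = "'p set \<times> ('p \<Rightarrow> real ^ 'k)"

definition chart_image :: "('p, 'k::finite) chart \<Rightarrow> (real ^ 'k) set" where
  "chart_image c = snd c ` fst c"

definition parametrization :: "('p, 'k::finite) chart \<Rightarrow> real ^ 'k \<Rightarrow> 'p" where
  "parametrization c = inv_into (fst c) (snd c)"

definition chart_of :: "'p topology \<Rightarrow> ('p, 'k::finite) chart \<Rightarrow> bool" where
  "chart_of X c \<longleftrightarrow>
     openin X (fst c) \<and> open (chart_image c) \<and>
     homeomorphic_map (subtopology X (fst c)) (top_of_set (chart_image c)) (snd c)"

text \<open>The expression of \<open>F\<close> in the charts \<open>c\<close> (of the source) and \<open>d\<close> (of the target),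
  and the set of coordinates where it makes sense.\<close>

definition local_dom ::
  "('p, 'k::finite) chart \<Rightarrow> ('q, 'm::finite) chart \<Rightarrow> ('p \<Rightarrow> 'q) \<Rightarrow> (real ^ 'k) set" where
  "local_dom c d F = snd c ` (fst c \<inter> F -` fst d)"

definition local_rep ::
  "('p, 'k::finite) chart \<Rightarrow> ('q, 'm::finite) chart \<Rightarrow> ('p \<Rightarrow> 'q) \<Rightarrow> real ^ 'k \<Rightarrow> real ^ 'm" where
  "local_rep c d F = snd d \<circ> F \<circ> parametrization c"

definition smooth_atlas :: "'p topology \<Rightarrow> ('p, 'k::finite) chart set \<Rightarrow> bool" where
  "smooth_atlas X A \<longleftrightarrow>
     (\<forall>c\<in>A. chart_of X c) \<and> (\<Union>c\<in>A. fst c) = topspace X \<and>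
     (\<forall>c\<in>A. \<forall>d\<in>A. smooth_on (local_dom c d id) (local_rep c d id))"

definition smooth_manifold :: "'p topology \<Rightarrow> ('p, 'k::finite) chart set \<Rightarrow> bool" where
  "smooth_manifold X A \<longleftrightarrow> Hausdorff_space X \<and> second_countable X \<and> smooth_atlas X A"

definition smooth_map ::
  "'p topology \<Rightarrow> ('p, 'k::finite) chart set \<Rightarrow> 'q topology \<Rightarrow> ('q, 'm::finite) chart set
    \<Rightarrow> ('p \<Rightarrow> 'q) \<Rightarrow> bool" where
  "smooth_map X A Y B F \<longleftrightarrow>
     continuous_map X Y F \<and>
     (\<forall>c\<in>A. \<forall>d\<in>B. smooth_on (local_dom c d F) (local_rep c d F))"

definition immersion ::
  "'p topology \<Rightarrow> ('p, 'k::finite) chart set \<Rightarrow> 'q topology \<Rightarrow> ('q, 'm::finite) chart set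
    \<Rightarrow> ('p \<Rightarrow> 'q) \<Rightarrow> bool" where
  "immersion X A Y B F \<longleftrightarrow>
     smooth_map X A Y B F \<and>
     (\<forall>c\<in>A. \<forall>d\<in>B. \<forall>x\<in>local_dom c d F. inj (frechet_derivative (local_rep c d F) (at x)))"

section \<open>Semi-Riemannian geometry in local coordinates\<close>

definition pd :: "'k::finite \<Rightarrow> (real ^ 'k \<Rightarrow> 'b::real_normed_vector) \<Rightarrow> real ^ 'k \<Rightarrow> 'b" where
  "pd i f x = frechet_derivative f (at x) (axis i 1)"

text \<open>In this section \<open>g\<close> is the Gram matrix of the metric as a function of the coordinates.
  \<open>christoffel g y a b c\<close> carries the upper index \<open>a\<close>.\<close>

definition christoffel ::
  "(real ^ 'm \<Rightarrow> real ^ 'm ^ 'm) \<Rightarrow> real ^ 'm \<Rightarrow> 'm::finite \<Rightarrow> 'm \<Rightarrow> 'm \<Rightarrow> real" where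
  "christoffel g y a b c =
     (1 / 2) * (\<Sum>d\<in>UNIV. matrix_inv (g y) $ a $ d *
       (pd b (\<lambda>z. g z $ d $ c) y + pd c (\<lambda>z. g z $ d $ b) y - pd d (\<lambda>z. g z $ b $ c) y))"

text \<open>\<open>riemann g y a b c d\<close> is the \<open>a\<close>-th component of \<open>R(\<partial>\<^sub>c, \<partial>\<^sub>d) \<partial>\<^sub>b\<close>, where
  \<open>R(X,Y) = [\<nabla>\<^sub>X, \<nabla>\<^sub>Y] - \<nabla>\<^bsub>[X,Y]\<^esub>\<close>; the Ricci tensor is the trace of
  \<open>X \<mapsto> R(X,Y)Z\<close>, so round spheres have positive Ricci curvature.\<close>

definition riemann ::
  "(real ^ 'm \<Rightarrow> real ^ 'm ^ 'm) \<Rightarrow> real ^ 'm \<Rightarrow> 'm::finite \<Rightarrow> 'm \<Rightarrow> 'm \<Rightarrow> 'm \<Rightarrow> real" where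
  "riemann g y a b c d =
     pd c (\<lambda>z. christoffel g z a d b) y - pd d (\<lambda>z. christoffel g z a c b) y +
     (\<Sum>e\<in>UNIV. christoffel g y a c e * christoffel g y e d b
               - christoffel g y a d e * christoffel g y e c b)"

definition ricci :: "(real ^ 'm \<Rightarrow> real ^ 'm ^ 'm) \<Rightarrow> real ^ 'm::finite \<Rightarrow> real ^ 'm ^ 'm" where
  "ricci g y = (\<chi> b d. \<Sum>a\<in>UNIV. riemann g y a b a d)"

text \<open>Below, \<open>\<Phi>\<close> is an immersion expressed in coordinates, with induced metric
  \<open>induced_metric g \<Phi>\<close>.\<close>

definition induced_metric ::
  "(real ^ 'm \<Rightarrow> real ^ 'm ^ 'm) \<Rightarrow> (real ^ 'k \<Rightarrow> real ^ 'm) \<Rightarrow> real ^ 'k \<Rightarrow> real ^ 'k::finite ^ 'k" where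
  "induced_metric g \<Phi> x = (\<chi> i j. pd i \<Phi> x \<bullet> (g (\<Phi> x) *v pd j \<Phi> x))"

definition covariant_pd ::
  "(real ^ 'm \<Rightarrow> real ^ 'm ^ 'm) \<Rightarrow> (real ^ 'k \<Rightarrow> real ^ 'm::finite)
    \<Rightarrow> 'k::finite \<Rightarrow> 'k \<Rightarrow> real ^ 'k \<Rightarrow> real ^ 'm" where
  "covariant_pd g \<Phi> i j x =
     pd i (pd j \<Phi>) x +
     (\<chi> a. \<Sum>b\<in>UNIV. \<Sum>c\<in>UNIV. christoffel g (\<Phi> x) a b c * pd i \<Phi> x $ b * pd j \<Phi> x $ c)"

text \<open>The component of \<open>v\<close> normal to \<open>T\<close> for the scalar product with Gram matrix \<open>G\<close>;
  it exists uniquely when the scalar product is nondegenerate on the subspace \<open>T\<close>.\<close>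

definition normal_part :: "real ^ 'm ^ 'm \<Rightarrow> (real ^ 'm) set \<Rightarrow> real ^ 'm \<Rightarrow> real ^ 'm::finite" where
  "normal_part G T v = (THE w. (\<forall>t\<in>T. w \<bullet> (G *v t) = 0) \<and> v - w \<in> T)"

definition second_fundamental_form ::
  "(real ^ 'm \<Rightarrow> real ^ 'm ^ 'm) \<Rightarrow> (real ^ 'k \<Rightarrow> real ^ 'm::finite)
    \<Rightarrow> 'k::finite \<Rightarrow> 'k \<Rightarrow> real ^ 'k \<Rightarrow> real ^ 'm" where
  "second_fundamental_form g \<Phi> i j x =
     normal_part (g (\<Phi> x)) (range (frechet_derivative \<Phi> (at x))) (covariant_pd g \<Phi> i j x)"

definition mean_curvature ::
  "(real ^ 'm \<Rightarrow> real ^ 'm ^ 'm) \<Rightarrow> (real ^ 'k::finite \<Rightarrow> real ^ 'm::finite)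
    \<Rightarrow> real ^ 'k \<Rightarrow> real ^ 'm" where
  "mean_curvature g \<Phi> x =
     (1 / real CARD('k)) *\<^sub>R (\<Sum>i\<in>UNIV. \<Sum>j\<in>UNIV.
        (matrix_inv (induced_metric g \<Phi> x) $ i $ j) *\<^sub>R second_fundamental_form g \<Phi> i j x)"

section \<open>Global notions\<close>

text \<open>A metric on a manifold is given by its Gram matrix in every chart of the atlas.\<close>

type_synonym ('p, 'm) metric = "('p, 'm) chart \<Rightarrow> real ^ 'm \<Rightarrow> real ^ 'm ^ 'm"

definition null_convergence :: "('q, 'm::finite) chart set \<Rightarrow> ('q, 'm) metric \<Rightarrow> bool" where
  "null_convergence B g \<longleftrightarrow>
     (\<forall>d\<in>B. \<forall>y\<in>chart_image d. \<forall>v. v \<bullet> (g d y *v v) = 0 \<longrightarrow> v \<bullet> (ricci (g d) y *v v) \<ge> 0)"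

definition spacelike ::
  "('p, 'k::finite) chart set \<Rightarrow> ('q, 'm::finite) chart set \<Rightarrow> ('q, 'm) metric \<Rightarrow> ('p \<Rightarrow> 'q) \<Rightarrow> bool"
  where
  "spacelike A B g F \<longleftrightarrow>
     (\<forall>c\<in>A. \<forall>d\<in>B. \<forall>x\<in>local_dom c d F. \<forall>v. v \<noteq> 0 \<longrightarrow>
        v \<bullet> (induced_metric (g d) (local_rep c d F) x *v v) > 0)"

definition stationary ::
  "('p, 'k::finite) chart set \<Rightarrow> ('q, 'm::finite) chart set \<Rightarrow> ('q, 'm) metric \<Rightarrow> ('p \<Rightarrow> 'q) \<Rightarrow> bool"
  where
  "stationary A B g F \<longleftrightarrow>
     (\<forall>c\<in>A. \<forall>d\<in>B. \<forall>x\<in>local_dom c d F. mean_curvature (g d) (local_rep c d F) x = 0)"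

section \<open>Spherical Robertson-Walker spacetimes\<close>

text \<open>The unit sphere of \<open>real ^ 'm\<close> has dimension \<open>n = CARD('m) - 1\<close>, so \<open>I \<times> S\<^sup>n\<close> has
  dimension \<open>CARD('m)\<close> and the type \<open>real ^ 'm\<close> also serves as its coordinate space.\<close>

definition rw_space :: "real set \<Rightarrow> (real \<times> (real ^ 'm::finite)) topology" where
  "rw_space I = top_of_set (I \<times> sphere 0 1)"

text \<open>The smooth structure as an embedded submanifold of \<open>real \<times> (real ^ 'm)\<close>: all charts
  whose inverse is a smooth immersion into the ambient vector space.\<close>

definition rw_atlas :: "real set \<Rightarrow> (real \<times> (real ^ 'm), 'm::finite) chart set" where
  "rw_atlas I = {d. chart_of (rw_space I) d \<and>
     smooth_on (chart_image d) (parametrization d) \<and>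
     (\<forall>y\<in>chart_image d. inj (frechet_derivative (parametrization d) (at y)))}"

text \<open>The tensor \<open>-ds\<^sup>2 + f(s)\<^sup>2 g\<close> at a point with first coordinate \<open>s\<close>, where the round
  metric \<open>g\<close> is the restriction of the Euclidean inner product to vectors tangent to the sphere.\<close>

definition rw_form ::
  "(real \<Rightarrow> real) \<Rightarrow> real \<Rightarrow> real \<times> (real ^ 'm::finite) \<Rightarrow> real \<times> (real ^ 'm) \<Rightarrow> real" where
  "rw_form f s v w = - (fst v * fst w) + (f s)\<^sup>2 * (snd v \<bullet> snd w)"

definition rw_metric :: "(real \<Rightarrow> real) \<Rightarrow> (real \<times> (real ^ 'm), 'm::finite) metric" where
  "rw_metric f d y =
     (\<chi> i j. rw_form f (fst (parametrization d y))
               (pd i (parametrization d) y) (pd j (parametrization d) y))"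

end

theory Submission
  imports Defs
begin

text \<open>Let \<open>\<tau>\<close> be the time coordinate restricted to a stationary compact spacelike submanifold of
  dimension \<open>k\<close>, with induced metric \<open>h\<close>.  In coordinates whose slot \<open>a\<close> is the time one has
  \<open>\<Gamma>\<^sup>a\<^sub>b\<^sub>c = (f'/f) g\<^sub>b\<^sub>c\<close> for \<open>b, c \<noteq> a\<close>.  At a critical point of \<open>\<tau>\<close> all tangent vectors have vanishing
  time component, so taking normal parts does not change time components, and the time
  component of the equation \<open>H = 0\<close> reads \<open>tr\<^sub>h (Hess \<tau>) + k f'/f = 0\<close>.  This is impossible at a minimum of
  \<open>\<tau>\<close> if \<open>f' > 0\<close>, and at a maximum if \<open>f' < 0\<close>.\<close>

section \<open>Functions of class C^k\<close>

lemma ck_on_const: "ck_on k S (\<lambda>_. c)"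
  by (induction k arbitrary: c) (auto simp: frechet_derivative_const)

text \<open>Around each point of the open set \<open>S\<close> the two functions agree on a
  neighbourhood, so their derivatives on \<open>S\<close> coincide and the induction passes to
  directional derivatives. It serves to replace \<open>parametrization\<close>, an
  \<open>inv_into\<close>, by an explicit formula valid only on the chart image.\<close>

lemma ck_on_cong:
  assumes "open S" and "\<And>x. x \<in> S \<Longrightarrow> f x = g x" and "ck_on k S f"
  shows "ck_on k S g"
  using assms(2,3)
proof (induction k arbitrary: f g)
  case 0
  then show ?case using continuous_on_cong by force
next
  case (Suc k)
  have D: "(g has_derivative frechet_derivative f (at x)) (at x)" if "x \<in> S" for x
    using Suc.prems that assms(1)
    by (intro has_derivative_transform_within_open[of f _ x UNIV S g])
      (auto simp: frechet_derivative_works)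
  have "ck_on k S (\<lambda>x. frechet_derivative g (at x) v)" for v
  proof (rule Suc.IH)
    show "frechet_derivative f (at x) v = frechet_derivative g (at x) v" if "x \<in> S" for x
      using frechet_derivative_at[OF D[OF that]] by simp
  qed (use Suc.prems in auto)
  then show ?case using D by (auto simp: differentiable_def)
qed

text \<open>Allows an explicit derivative formula in place of \<open>frechet_derivative\<close>; the
  closure properties below that argue by induction use it.\<close>

lemma ck_on_SucI:
  assumes "open S" and D: "\<And>x. x \<in> S \<Longrightarrow> (f has_derivative D x) (at x)"
    and "\<And>v. ck_on k S (\<lambda>x. D x v)"
  shows "ck_on (Suc k) S f"
proof -
  have "ck_on k S (\<lambda>x. frechet_derivative f (at x) v)" for v
    by (rule ck_on_cong[OF assms(1) _ assms(3)[of v]]) (simp add: frechet_derivative_at[OF D])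
  then show ?thesis using D by (auto simp: differentiable_def)
qed

lemma ck_on_Suc_has_derivative:
  "ck_on (Suc k) S f \<Longrightarrow> x \<in> S \<Longrightarrow> (f has_derivative frechet_derivative f (at x)) (at x)"
  by (simp add: frechet_derivative_works)

lemma ck_on_Suc_imp: "ck_on (Suc k) S f \<Longrightarrow> ck_on k S f"
proof (induction k arbitrary: f)
  case 0
  then show ?case
    by (auto intro!: continuous_at_imp_continuous_on differentiable_imp_continuous_within)
next
  case (Suc k)
  have "ck_on k S (\<lambda>x. frechet_derivative f (at x) v)" for v
    using Suc.prems by (intro Suc.IH) (simp only: ck_on.simps(2)[of "Suc k"])
  then show ?case using Suc.prems by simp
qed

lemma ck_on_bounded_linear_compose:
  assumes "open S" "bounded_linear L" "ck_on k S f"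
  shows "ck_on k S (\<lambda>x. L (f x))"
  using assms(3)
proof (induction k arbitrary: f)
  case 0
  then show ?case by (simp add: bounded_linear.continuous_on[OF assms(2)])
next
  case (Suc k)
  show ?case
  proof (rule ck_on_SucI[OF assms(1)])
    show "((\<lambda>x. L (f x)) has_derivative (\<lambda>v. L (frechet_derivative f (at x) v))) (at x)"
      if "x \<in> S" for x
      using ck_on_Suc_has_derivative[OF Suc.prems that]
      by (rule bounded_linear.has_derivative[OF assms(2)])
  qed (use Suc in auto)
qed

lemma ck_on_bounded_linear:
  assumes "open S" "bounded_linear L"
  shows "ck_on k S L"
proof (cases k)
  case 0
  then show ?thesis using assms by (simp add: linear_continuous_on)
next
  case (Suc j)
  show ?thesis unfolding Suc
    by (rule ck_on_SucI[OF assms(1) bounded_linear_imp_has_derivative[OF assms(2)] ck_on_const])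
qed

lemma ck_on_add:
  assumes "open S" "ck_on k S f" "ck_on k S g"
  shows "ck_on k S (\<lambda>x. f x + g x)"
  using assms(2,3)
proof (induction k arbitrary: f g)
  case 0
  then show ?case by (simp add: continuous_on_add)
next
  case (Suc k)
  show ?case
    by (rule ck_on_SucI[OF assms(1) has_derivative_add[OF Suc.prems[THEN ck_on_Suc_has_derivative]]])
      (use Suc in auto)
qed

lemma ck_on_mult:
  fixes f g :: "'a::real_normed_vector \<Rightarrow> real"
  assumes "open S" "ck_on k S f" "ck_on k S g"
  shows "ck_on k S (\<lambda>x. f x * g x)"
  using assms(2,3)
proof (induction k arbitrary: f g)
  case 0
  then show ?case by (simp add: continuous_on_mult)
next
  case (Suc k)
  show ?case
    by (rule ck_on_SucI[OF assms(1) has_derivative_mult[OF Suc.prems[THEN ck_on_Suc_has_derivative]]])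
      (use Suc Suc.prems[THEN ck_on_Suc_imp] in \<open>auto intro!: ck_on_add[OF assms(1)]\<close>)
qed

text \<open>The exponent is arbitrary because differentiating \<open>u powr p\<close> produces
  \<open>u powr (p - 1)\<close>; with all exponents in the claim the induction closes, which it
  would not for the square root alone.\<close>

lemma ck_on_powr:
  fixes u :: "'a::real_normed_vector \<Rightarrow> real"
  assumes "open S" and pos: "\<And>x. x \<in> S \<Longrightarrow> 0 < u x" and "ck_on k S u"
  shows "ck_on k S (\<lambda>x. u x powr p)"
  using assms(3)
proof (induction k arbitrary: p)
  case 0
  then show ?case using pos
    by (auto intro!: continuous_on_powr continuous_on_const simp: less_imp_neq[symmetric])
next
  case (Suc k)
  show ?case
  proof (rule ck_on_SucI[OF assms(1)])
    show "((\<lambda>x. u x powr p) has_derivative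
        (\<lambda>v. (p * u x powr (p - 1)) * frechet_derivative u (at x) v)) (at x)"
      if "x \<in> S" for x
      using has_derivative_powr[OF ck_on_Suc_has_derivative[OF Suc.prems that]
          has_derivative_const[of p] pos[OF that] UNIV_I] pos[OF that]
      by (auto elim!: back_subst[of "\<lambda>D. (_ has_derivative D) _"] simp: fun_eq_iff powr_diff)
    show "ck_on k S (\<lambda>x. (p * u x powr (p - 1)) * frechet_derivative u (at x) v)" for v
      using Suc.prems Suc.IH[of "p - 1"] ck_on_Suc_imp[OF Suc.prems]
      by (intro ck_on_mult[OF assms(1)] ck_on_const) auto
  qed
qed

lemma ck_on_sqrt:
  fixes u :: "'a::real_normed_vector \<Rightarrow> real"
  assumes "open S" and "\<And>x. x \<in> S \<Longrightarrow> 0 < u x" and "ck_on k S u"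
  shows "ck_on k S (\<lambda>x. sqrt (u x))"
  by (rule ck_on_cong[OF assms(1) _ ck_on_powr[OF assms, where p = "1/2"]])
    (use assms(2) in \<open>auto simp: powr_half_sqrt less_imp_le\<close>)

section \<open>Partial derivatives and composition with linear maps\<close>

lemma pd_eq: "(h has_derivative D) (at x) \<Longrightarrow> pd i h x = D (axis i 1)"
  by (simp add: pd_def frechet_derivative_at[symmetric])

lemma ck_on_pd:
  assumes "ck_on (Suc k) S \<Phi>"
  shows "ck_on k S (pd j \<Phi>)"
proof -
  have "ck_on k S (\<lambda>z. frechet_derivative \<Phi> (at z) (axis j 1))"
    using assms by (simp only: ck_on.simps(2))
  then show ?thesis unfolding pd_def[abs_def] .
qed

lemma pd_bounded_linear_compose:
  assumes "bounded_linear K" "ck_on (Suc k) S \<Phi>" "x \<in> S"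
  shows "pd i (\<lambda>z. K (\<Phi> z)) x = K (pd i \<Phi> x)"
  using pd_eq[OF bounded_linear.has_derivative[OF assms(1) ck_on_Suc_has_derivative[OF assms(2,3)]]]
  by (simp add: pd_def)

text \<open>The first partial derivative commutes with \<open>K\<close> only at points of
  \<open>S\<close>; openness of \<open>S\<close> makes this an identity near \<open>x\<close>, which
  may be differentiated again.\<close>

lemma pd_pd_bounded_linear_compose:
  assumes K: "bounded_linear K" and "ck_on (Suc (Suc k)) S \<Phi>" "open S" "x \<in> S"
  shows "pd i (pd j (\<lambda>z. K (\<Phi> z))) x = K (pd i (pd j \<Phi>) x)"
proof -
  have "(pd j (\<lambda>z. K (\<Phi> z)) has_derivative (\<lambda>v. K (frechet_derivative (pd j \<Phi>) (at x) v))) (at x)"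
    by (rule has_derivative_transform_within_open[OF bounded_linear.has_derivative[OF K
            ck_on_Suc_has_derivative[OF ck_on_pd[OF assms(2)] assms(4)]] assms(3,4)])
      (rule pd_bounded_linear_compose[OF K assms(2), symmetric])
  from pd_eq[OF this] show ?thesis by (simp add: pd_def[of i "pd j \<Phi>"])
qed

section \<open>Second derivatives at a minimum\<close>

lemma linear_axis_expansion:
  fixes L :: "real^'n \<Rightarrow> 'b::real_vector"
  assumes "linear L"
  shows "L v = (\<Sum>i\<in>UNIV. v $ i *\<^sub>R L (axis i 1))"
proof -
  have "v = (\<Sum>i\<in>UNIV. v $ i *\<^sub>R axis i 1)"
    using basis_expansion[of v] by (simp add: scalar_mult_eq_scaleR)
  then have "L v = L (\<Sum>i\<in>UNIV. v $ i *\<^sub>R axis i 1)" by simp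
  also have "\<dots> = (\<Sum>i\<in>UNIV. v $ i *\<^sub>R L (axis i 1))"
    using assms by (simp add: linear_sum linear_scale)
  finally show ?thesis .
qed

text \<open>Identifies a matrix of coordinate products with the pull-back of \<open>\<beta>\<close>
  along \<open>L\<close>. It applies to the spacetime metric (pull-back of \<open>rw_form\<close>)
  and to the induced metric (pull-back of the former), so that definiteness and degeneracy can be
  read off from the form.\<close>

lemma gram_matrix_form:
  fixes L :: "real^'n \<Rightarrow> 'b::real_vector" and \<beta> :: "'b \<Rightarrow> 'b \<Rightarrow> real"
  assumes L: "linear L" and \<beta>: "bilinear \<beta>"
  shows "v \<bullet> ((\<chi> i j. \<beta> (L (axis i 1)) (L (axis j 1))) *v w) = \<beta> (L v) (L w)"
proof -
  have "\<beta> (L v) (L w) = \<beta> (\<Sum>i\<in>UNIV. v $ i *\<^sub>R L (axis i 1)) (\<Sum>j\<in>UNIV. w $ j *\<^sub>R L (axis j 1))"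
    by (simp only: linear_axis_expansion[OF L, symmetric])
  also have "\<dots> = (\<Sum>i\<in>UNIV. \<Sum>j\<in>UNIV. v $ i * (w $ j * \<beta> (L (axis i 1)) (L (axis j 1))))"
    using \<beta> by (simp add: bilinear_sum sum.cartesian_product bilinear_lmul bilinear_rmul)
  finally show ?thesis
    by (simp add: inner_vec_def matrix_vector_mult_def sum_distrib_left mult_ac)
qed

lemma bilinear_matrix: "bilinear (\<lambda>v w. v \<bullet> ((G :: real^'n^'n) *v w))"
  unfolding bilinear_def
  by (auto intro!: linearI simp: inner_add_left inner_add_right matrix_vector_right_distrib
      matrix_vector_mult_scaleR)

text \<open>Restriction to the line through \<open>x\<close> in direction \<open>v\<close> reduces
  this to one variable, where \<open>E v\<close> is the second derivative. Were it negative, the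
  first derivative, zero at the start, would be negative just after it, and the mean value theorem
  would give a value below the minimum.\<close>

lemma local_min_second_derivative:
  fixes \<phi> :: "'a::real_normed_vector \<Rightarrow> real"
  assumes "open S" "x \<in> S" and \<phi>: "\<And>z. z \<in> S \<Longrightarrow> (\<phi> has_derivative D z) (at z)"
    and E: "((\<lambda>z. D z v) has_derivative E) (at x)"
    and min: "\<And>z. z \<in> S \<Longrightarrow> \<phi> x \<le> \<phi> z"
  shows "D x v = 0" and "0 \<le> E v"
proof -
  define \<gamma> where "\<gamma> = (\<lambda>t. x + t *\<^sub>R v)"
  have \<gamma>: "(\<gamma> has_derivative (\<lambda>h. h *\<^sub>R v)) (at t)" for t
    unfolding \<gamma>_def by (auto intro!: derivative_eq_intros)
  have "open (\<gamma> -` S)"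
    unfolding \<gamma>_def by (intro open_vimage assms continuous_intros)
  moreover have "0 \<in> \<gamma> -` S" using assms(2) by (simp add: \<gamma>_def)
  ultimately obtain d where "d > 0" "\<forall>t. dist t 0 < d \<longrightarrow> t \<in> \<gamma> -` S"
    unfolding open_dist by blast
  then have d: "d > 0" "\<And>t. \<bar>t\<bar> < d \<Longrightarrow> \<gamma> t \<in> S" by (auto simp: dist_real_def)
  have h: "((\<lambda>t. \<phi> (\<gamma> t)) has_real_derivative D (\<gamma> t) v) (at t)" if "\<bar>t\<bar> < d" for t
  proof -
    have "((\<lambda>t. \<phi> (\<gamma> t)) has_derivative (\<lambda>h. D (\<gamma> t) (h *\<^sub>R v))) (at t)"
      by (rule has_derivative_compose[OF \<gamma> \<phi>[OF d(2)[OF that]]])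
    then show ?thesis
      unfolding has_field_derivative_def
      by (rule has_derivative_eq_rhs)
        (simp add: fun_eq_iff linear_scale[OF has_derivative_linear[OF \<phi>[OF d(2)[OF that]]]])
  qed
  have \<gamma>0: "\<gamma> 0 = x" by (simp add: \<gamma>_def)
  show Dx: "D x v = 0"
    using DERIV_local_min[OF h[of 0] d(1)] d min by (simp add: \<gamma>0)
  show "0 \<le> E v"
  proof (rule ccontr)
    assume "\<not> 0 \<le> E v"
    then have neg: "E v < 0" by simp
    have "((\<lambda>t. D (\<gamma> t) v) has_derivative (\<lambda>h. E (h *\<^sub>R v))) (at 0)"
      by (rule has_derivative_compose[OF \<gamma>]) (simp add: \<gamma>0 E)
    then have "((\<lambda>t. D (\<gamma> t) v) has_real_derivative E v) (at 0)"
      unfolding has_field_derivative_def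
      by (rule has_derivative_eq_rhs)
        (simp add: fun_eq_iff linear_scale[OF has_derivative_linear[OF E]])
    from DERIV_neg_dec_right[OF this neg] obtain e
      where e: "e > 0" "\<And>t. 0 < t \<Longrightarrow> t < e \<Longrightarrow> D (\<gamma> t) v < 0"
      using Dx by (auto simp: \<gamma>0)
    \<comment> \<open>Half the minimum is strictly inside both ranges: the line is still in
      \<open>S\<close>, and the derivative is negative on all of \<open>(0, t)\<close>.\<close>
    define t where "t = min d e / 2"
    have t: "0 < t" "t < d" "t < e" using d(1) e(1) by (auto simp: t_def)
    obtain \<xi> where \<xi>: "0 < \<xi>" "\<xi> < t" "\<phi> (\<gamma> t) - \<phi> (\<gamma> 0) = (t - 0) * D (\<gamma> \<xi>) v"
      using MVT2[OF t(1), of "\<lambda>t. \<phi> (\<gamma> t)" "\<lambda>t. D (\<gamma> t) v"] h t by force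
    have "\<phi> (\<gamma> t) - \<phi> (\<gamma> 0) < 0"
      unfolding \<xi>(3) using \<xi>(1,2) t e(2)[of \<xi>] by (simp add: mult_pos_neg)
    then show False using min[OF d(2)[of t]] t by (simp add: \<gamma>0)
  qed
qed

text \<open>Expanding \<open>v\<close> in the axes turns the directional derivative into a
  combination of partial derivatives, and its derivative along \<open>v\<close> into the quadratic
  form of the Hessian matrix.\<close>

lemma local_min_gradient_hessian:
  fixes \<phi> :: "real^'k \<Rightarrow> real"
  assumes "open S" "x \<in> S" and ck: "ck_on (Suc (Suc 0)) S \<phi>"
    and min: "\<And>z. z \<in> S \<Longrightarrow> \<phi> x \<le> \<phi> z"
  shows "pd i \<phi> x = 0" and "0 \<le> v \<bullet> ((\<chi> i j. pd i (pd j \<phi>) x) *v v)"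
proof -
  let ?D = "\<lambda>z. frechet_derivative \<phi> (at z)"
  have \<phi>: "(\<phi> has_derivative ?D z) (at z)" if "z \<in> S" for z
    by (rule ck_on_Suc_has_derivative[OF ck that])
  have pd2: "(pd j \<phi> has_derivative frechet_derivative (pd j \<phi>) (at x)) (at x)" for j
  proof -
    have "ck_on (Suc 0) S (\<lambda>z. ?D z (axis j 1))"
      using ck by (simp only: ck_on.simps(2)[of "Suc 0"])
    then show ?thesis using ck_on_Suc_has_derivative assms(2) unfolding pd_def[abs_def] by blast
  qed
  have sum: "(\<Sum>j\<in>UNIV. v $ j * pd j \<phi> z) = ?D z v" if "z \<in> S" for z v
    unfolding pd_def
    using linear_axis_expansion[OF has_derivative_linear[OF \<phi>[OF that]], of v] by simp
  have E: "((\<lambda>z. ?D z v) has_derivative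
      (\<lambda>h. \<Sum>j\<in>UNIV. v $ j * frechet_derivative (pd j \<phi>) (at x) h)) (at x)" for v
    by (rule has_derivative_transform_within_open[OF _ assms(1,2) sum])
      (intro has_derivative_sum has_derivative_mult_right pd2)
  note crit = local_min_second_derivative[OF assms(1,2) \<phi> E min]
  show "pd i \<phi> x = 0" unfolding pd_def by (rule crit(1))
  have "(\<Sum>j\<in>UNIV. v $ j * frechet_derivative (pd j \<phi>) (at x) v) =
      (\<Sum>j\<in>UNIV. \<Sum>i\<in>UNIV. v $ j * (v $ i * pd i (pd j \<phi>) x))"
    unfolding pd_def[of _ "pd _ \<phi>"]
    using linear_axis_expansion[OF has_derivative_linear[OF pd2], where v = v]
    by (simp add: sum_distrib_left)
  also have "\<dots> = v \<bullet> ((\<chi> i j. pd i (pd j \<phi>) x) *v v)"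
    by (subst sum.swap) (simp add: inner_vec_def matrix_vector_mult_def sum_distrib_left mult_ac)
  finally show "0 \<le> v \<bullet> ((\<chi> i j. pd i (pd j \<phi>) x) *v v)" using crit(2)[of v] by simp
qed

section \<open>Positive matrices and normal parts\<close>

text \<open>With zero diagonal entry the form at \<open>t e_i + e_j\<close> is affine in
  \<open>t\<close> with slope \<open>2 * M $ i $ j\<close>, hence unbounded below unless the slope
  vanishes.\<close>

lemma psd_row_zero:
  fixes M :: "real^'n^'n"
  assumes "M $ j $ i = M $ i $ j" and psd: "\<And>v. 0 \<le> v \<bullet> (M *v v)" and "M $ i $ i = 0"
  shows "M $ i $ j = 0"
proof (rule ccontr)
  assume nz: "M $ i $ j \<noteq> 0"
  \<comment> \<open>Solves \<open>2 * t * M $ i $ j + M $ j $ j = - 1\<close>.\<close>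
  define t where "t = - (M $ j $ j + 1) / (2 * M $ i $ j)"
  have col: "M *v axis l 1 = (\<chi> r. M $ r $ l)" for l
    by (simp add: matrix_vector_mult_basis column_def)
  have "(t *\<^sub>R axis i 1 + axis j 1) \<bullet> (M *v (t *\<^sub>R axis i 1 + axis j 1)) =
      t * t * M $ i $ i + t * M $ i $ j + t * M $ j $ i + M $ j $ j"
    by (simp add: matrix_vector_right_distrib matrix_vector_mult_scaleR col inner_add_left
        inner_add_right inner_axis' algebra_simps)
  also have "\<dots> = 2 * (t * M $ i $ j) + M $ j $ j" using assms(1,3) by simp
  also have "t * M $ i $ j = - (M $ j $ j + 1) / 2" using nz by (simp add: t_def)
  finally show False using psd[of "t *\<^sub>R axis i 1 + axis j 1"] by (simp add: field_simps)
qed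

text \<open>Symmetric Gaussian elimination writes \<open>M\<close> as a sum of rank-one matrices
  \<open>w w^T / m\<close> with \<open>m > 0\<close>; each contributes
  \<open>w \<bullet> (H *v w) / m\<close>, which is nonnegative.\<close>

lemma trace_psd_mult_nonneg:
  fixes M H :: "real^'n^'n"
  assumes "\<And>i j. M $ i $ j = M $ j $ i" and "\<And>v. 0 \<le> v \<bullet> (M *v v)"
    and H: "\<And>v. 0 \<le> v \<bullet> (H *v v)"
  shows "0 \<le> (\<Sum>i\<in>UNIV. \<Sum>j\<in>UNIV. M $ i $ j * H $ i $ j)"
proof -
  \<comment> \<open>The induction runs over a set \<open>S\<close> of indices outside which the rows
    of \<open>M\<close> vanish; every elimination step removes one index.\<close>
  have "0 \<le> (\<Sum>i\<in>UNIV. \<Sum>j\<in>UNIV. M $ i $ j * H $ i $ j)"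
    if "finite S" "\<And>i j. M $ i $ j = M $ j $ i" "\<And>v. 0 \<le> v \<bullet> (M *v v)"
      "\<And>i j. i \<notin> S \<Longrightarrow> M $ i $ j = 0"
    for S and M :: "real^'n^'n"
    using that
  proof (induction S arbitrary: M rule: finite_induct)
    case empty
    then show ?case by simp
  next
    case (insert i S)
    note sym = insert.prems(1) and psd = insert.prems(2) and supp = insert.prems(3)
    show ?case
    proof (cases "M $ i $ i = 0")
      case True
      \<comment> \<open>A zero pivot forces its row to vanish, so there is nothing to
        eliminate.\<close>
      have row: "M $ i $ j = 0" for j by (rule psd_row_zero[OF sym psd True])
      show ?thesis
      proof (rule insert.IH[OF sym psd])
        show "M $ p $ q = 0" if "p \<notin> S" for p q using that supp row by (cases "p = i") auto
      qed
    next
      case False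
      define m where "m = M $ i $ i"
      define w where "w = M $ i"
      \<comment> \<open>\<open>N\<close> is \<open>M\<close> minus the rank-one matrix with the same
        row and column \<open>i\<close>, as in a Schur complement with pivot
        \<open>m\<close>.\<close>
      define N where "N = (\<chi> p q. M $ p $ q - w $ p * w $ q / m)"
      have Mi: "M *v axis i 1 = w"
        using sym by (auto simp add: w_def matrix_vector_mult_basis column_def vec_eq_iff)
      have wM: "(M *v v) $ i = w \<bullet> v" for v
        by (simp add: w_def matrix_vector_mult_def inner_vec_def)
      have wi: "w $ i = m" by (simp add: w_def m_def)
      have "0 \<le> m" using psd[of "axis i 1"] by (simp add: Mi inner_axis' wi)
      then have m: "m > 0" using False m_def by simp
      have symN: "N $ p $ q = N $ q $ p" for p q
        using sym[of p q] by (simp add: N_def mult.commute)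
      have Nv: "N *v v = M *v v - ((w \<bullet> v) / m) *\<^sub>R w" for v
        by (simp add: vec_eq_iff N_def matrix_vector_mult_def inner_vec_def sum_distrib_left
            sum_distrib_right sum_divide_distrib algebra_simps sum_subtractf)
      have psdN: "0 \<le> v \<bullet> (N *v v)" for v
      proof -
        \<comment> \<open>This \<open>t\<close> minimizes the form of \<open>M\<close> along
          \<open>v + t e_i\<close>, and the minimum is exactly
          \<open>v \<bullet> (N *v v)\<close>.\<close>
        define t where "t = - (w \<bullet> v) / m"
        have "0 \<le> (v + t *\<^sub>R axis i 1) \<bullet> (M *v (v + t *\<^sub>R axis i 1))"
          by (rule psd)
        also have "\<dots> = v \<bullet> (M *v v) + 2 * t * (w \<bullet> v) + t * (t * m)"
          by (simp add: matrix_vector_right_distrib matrix_vector_mult_scaleR Mi wM inner_add_left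
              inner_add_right inner_axis' inner_commute[of v w] wi algebra_simps)
        also have "t * m = - (w \<bullet> v)" using m by (simp add: t_def)
        also have "v \<bullet> (M *v v) + 2 * t * (w \<bullet> v) + t * - (w \<bullet> v) = v \<bullet> (N *v v)"
          by (simp add: Nv inner_diff_right inner_commute[of v w] t_def)
        finally show ?thesis .
      qed
      have zero: "N $ p $ q = 0" if "p \<notin> S" for p q
      proof (cases "p = i")
        case True
        then show ?thesis using m by (simp add: N_def w_def m_def)
      next
        case False
        then have "M $ p $ q = 0" "M $ i $ p = 0" using that supp[of p] sym[of p i] by auto
        then show ?thesis by (simp add: N_def w_def)
      qed
      have "(\<Sum>q\<in>UNIV. M $ p $ q * H $ p $ q)
          = (\<Sum>q\<in>UNIV. N $ p $ q * H $ p $ q) + w $ p * (H *v w) $ p / m" for p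
        by (simp add: N_def matrix_vector_mult_def sum_distrib_left sum_divide_distrib
            algebra_simps sum_subtractf)
      then have "(\<Sum>p\<in>UNIV. \<Sum>q\<in>UNIV. M $ p $ q * H $ p $ q)
          = (\<Sum>p\<in>UNIV. \<Sum>q\<in>UNIV. N $ p $ q * H $ p $ q) + w \<bullet> (H *v w) / m"
        by (simp add: sum.distrib inner_vec_def sum_divide_distrib)
      then show ?thesis using insert.IH[OF symN psdN zero] H[of w] m by simp
    qed
  qed
  from this[of UNIV M] assms show ?thesis by auto
qed

section \<open>Inverses of definite matrices and orthogonal decomposition\<close>

lemma matrix_inv_right_of_ker:
  fixes M :: "real^'n^'n"
  assumes "\<And>v. M *v v = 0 \<Longrightarrow> v = 0"
  shows "M ** matrix_inv M = mat 1"
proof -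
  have "invertible M"
    using assms by (simp add: invertible_left_inverse matrix_left_invertible_ker)
  then have "\<exists>M'. M ** M' = mat 1 \<and> M' ** M = mat 1" by (simp add: invertible_def)
  from someI_ex[OF this] show ?thesis by (simp add: matrix_inv_def)
qed

text \<open>By symmetry the transposed right inverse is a left inverse, hence equal to it. For
  positivity put \<open>w = matrix_inv B *v v\<close>, so that
  \<open>v \<bullet> w = w \<bullet> (B *v w)\<close>.\<close>

lemma matrix_inv_posdef:
  fixes B :: "real^'n^'n"
  assumes sym: "transpose B = B" and pos: "\<And>v. v \<noteq> 0 \<Longrightarrow> 0 < v \<bullet> (B *v v)"
  shows "B ** matrix_inv B = mat 1"
    and "transpose (matrix_inv B) = matrix_inv B" and "0 \<le> v \<bullet> (matrix_inv B *v v)"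
proof -
  have ker: "v = 0" if "B *v v = 0" for v using pos[of v] that by force
  show 1: "B ** matrix_inv B = mat 1" by (rule matrix_inv_right_of_ker) (rule ker)
  have "transpose (matrix_inv B) ** B = transpose (B ** matrix_inv B)"
    by (simp add: matrix_transpose_mul sym)
  also have "\<dots> = mat 1" by (simp add: 1 transpose_mat)
  finally have "transpose (matrix_inv B) ** (B ** matrix_inv B) = matrix_inv B"
    by (simp add: matrix_mul_assoc)
  then show "transpose (matrix_inv B) = matrix_inv B" by (simp add: 1)
  define w where "w = matrix_inv B *v v"
  have "B *v w = v" by (simp add: w_def matrix_vector_mul_assoc 1)
  then have "v \<bullet> w = w \<bullet> (B *v w)" by (simp add: inner_commute)
  also have "\<dots> \<ge> 0" using pos[of w] by (cases "w = 0") auto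
  finally show "0 \<le> v \<bullet> (matrix_inv B *v v)" by (simp add: w_def)
qed

text \<open>\<open>normal_part\<close> is a definite description, so existence and uniqueness come
  first. The form \<open>G\<close> may be indefinite; its restriction to \<open>range L\<close> is
  positive definite, which makes the Gram matrix \<open>B\<close> there invertible.\<close>

lemma normal_part_diff_in:
  fixes L :: "real^'k \<Rightarrow> real^'m" and G :: "real^'m^'m"
  assumes L: "linear L" and G: "\<And>v w. v \<bullet> (G *v w) = w \<bullet> (G *v v)"
    and pos: "\<And>v. v \<noteq> 0 \<Longrightarrow> 0 < L v \<bullet> (G *v L v)"
  shows "v - normal_part G (range L) v \<in> range L"
proof -
  define B where "B = (\<chi> i j. L (axis i 1) \<bullet> (G *v L (axis j 1)))"
  have B: "p \<bullet> (B *v q) = L p \<bullet> (G *v L q)" for p q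
    unfolding B_def by (rule gram_matrix_form[OF L bilinear_matrix])
  have "transpose B = B" using G by (simp add: B_def transpose_def vec_eq_iff)
  moreover have "0 < p \<bullet> (B *v p)" if "p \<noteq> 0" for p using pos[OF that] by (simp add: B)
  ultimately have inv: "B ** matrix_inv B = mat 1" by (rule matrix_inv_posdef)
  \<comment> \<open>The normal equations: \<open>L c\<close> has the same products as
    \<open>v\<close> with all tangent vectors, so \<open>v - L c\<close> is normal.\<close>
  define c where "c = matrix_inv B *v (\<chi> i. v \<bullet> (G *v L (axis i 1)))"
  have Bc: "B *v c = (\<chi> i. v \<bullet> (G *v L (axis i 1)))"
    by (simp add: c_def matrix_vector_mul_assoc inv)
  define Q where "Q = (\<lambda>w. (\<forall>t\<in>range L. w \<bullet> (G *v t) = 0) \<and> v - w \<in> range L)"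
  have "Q (v - L c)"
  proof -
    have "(v - L c) \<bullet> (G *v L u) = 0" for u
    proof -
      have "v \<bullet> (G *v L u) = (\<Sum>i\<in>UNIV. u $ i *\<^sub>R (v \<bullet> (G *v L (axis i 1))))"
        by (rule linear_axis_expansion)
          (auto intro!: linearI simp: linear_add[OF L] linear_scale[OF L]
            matrix_vector_right_distrib matrix_vector_mult_scaleR inner_add_right)
      also have "\<dots> = u \<bullet> (B *v c)" by (simp add: Bc inner_vec_def)
      also have "\<dots> = L c \<bullet> (G *v L u)" by (simp add: B G[of "L c"])
      finally show ?thesis by (simp add: inner_diff_left)
    qed
    then show ?thesis by (auto simp: Q_def)
  qed
  \<comment> \<open>The difference of two candidates is both tangent and normal, so positivity makes
    it zero.\<close>
  moreover have "w = w'" if ww: "Q w" "Q w'" for w w'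
  proof -
    obtain p q where "v - w = L p" "v - w' = L q" using ww unfolding Q_def by blast
    then have "w - w' = L (q - p)" by (simp add: linear_diff[OF L] algebra_simps)
    then obtain u where u: "w - w' = L u" by blast
    have "(w - w') \<bullet> (G *v L u) = 0" using ww by (simp add: Q_def inner_diff_left)
    then have "u = 0" using pos[of u] by (force simp: u)
    then show ?thesis using u linear_0[OF L] by simp
  qed
  ultimately have "Q (THE w. Q w)" by (metis theI)
  then show ?thesis by (simp add: Q_def normal_part_def)
qed

section \<open>Graph charts of the spacetime\<close>

text \<open>Near a point of the sphere whose coordinate \<open>a\<close> has sign \<open>\<sigma>\<close> the time coordinate \<open>s\<close> takes
  the slot of the redundant coordinate \<open>x $ a\<close>; the latter is recovered as
  \<open>\<sigma> * sqrt (1 - y \<bullet> y + (y $ a)\<^sup>2)\<close>, in which \<open>y $ a\<close> cancels.\<close>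

definition graph_param :: "'m \<Rightarrow> real \<Rightarrow> real ^ 'm \<Rightarrow> real \<times> (real ^ 'm::finite)" where
  "graph_param a \<sigma> y =
     (y $ a, y + (\<sigma> * sqrt (1 - y \<bullet> y + (y $ a)\<^sup>2) - y $ a) *\<^sub>R axis a 1)"

definition graph_chart :: "real set \<Rightarrow> 'm \<Rightarrow> real \<Rightarrow> (real \<times> (real ^ 'm), 'm::finite) chart" where
  "graph_chart I a \<sigma> =
     ({p. fst p \<in> I \<and> norm (snd p) = 1 \<and> \<sigma> * snd p $ a > 0},
      \<lambda>p. snd p + (fst p - snd p $ a) *\<^sub>R axis a 1)"

text \<open>A cylinder: the time lies in \<open>I\<close> and the other coordinates lie in the open
  unit ball. It is the chart image for both signs \<open>\<sigma>\<close>.\<close>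

definition graph_dom :: "real set \<Rightarrow> 'm \<Rightarrow> (real ^ 'm::finite) set" where
  "graph_dom I a = {y. y $ a \<in> I \<and> 0 < 1 - y \<bullet> y + (y $ a)\<^sup>2}"

lemma open_graph_dom:
  assumes "open I"
  shows "open (graph_dom I a)"
proof -
  have "graph_dom I a = (\<lambda>y. y $ a) -` I \<inter> {y. 0 < 1 - y \<bullet> y + (y $ a)\<^sup>2}"
    by (auto simp: graph_dom_def)
  also have "open \<dots>"
    by (intro open_Int open_vimage assms open_Collect_less continuous_intros)
  finally show ?thesis .
qed

text \<open>\<open>\<sigma> * \<sigma> = 1\<close> encodes a sign. The restored sphere coordinate
  \<open>\<sigma> * r\<close> then has the radicand as its square, which completes the norm to
  1.\<close>

lemma graph_param_in_chart:
  assumes "\<sigma> * \<sigma> = 1" "y \<in> graph_dom I a"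
  shows "graph_param a \<sigma> y \<in> fst (graph_chart I a \<sigma>)"
    and "snd (graph_chart I a \<sigma>) (graph_param a \<sigma> y) = y"
proof -
  define r where "r = sqrt (1 - y \<bullet> y + (y $ a)\<^sup>2)"
  have r: "r > 0" and r2: "r * r = 1 - y \<bullet> y + (y $ a)\<^sup>2"
    using assms(2) by (auto simp: r_def graph_dom_def)
  define x where "x = y + (\<sigma> * r - y $ a) *\<^sub>R axis a 1"
  have P: "graph_param a \<sigma> y = (y $ a, x)" by (simp add: graph_param_def r_def x_def)
  have xa: "x $ a = \<sigma> * r" by (simp add: x_def)
  have "x \<bullet> x = y \<bullet> y - (y $ a)\<^sup>2 + (\<sigma> * \<sigma>) * (r * r)"
    by (simp add: x_def inner_add_left inner_add_right inner_axis inner_axis' power2_eq_square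
        algebra_simps)
  then have "norm x = 1" by (simp add: assms(1) r2 norm_eq_1)
  moreover have "\<sigma> * x $ a > 0" using r assms(1) by (simp add: xa flip: mult.assoc)
  ultimately show "graph_param a \<sigma> y \<in> fst (graph_chart I a \<sigma>)"
    using assms(2) by (simp add: P graph_chart_def graph_dom_def)
  show "snd (graph_chart I a \<sigma>) (graph_param a \<sigma> y) = y"
    by (simp add: P graph_chart_def xa) (simp add: x_def vec_eq_iff axis_def)
qed

text \<open>At the image of a point \<open>(s, x)\<close> the radicand is the square of
  \<open>x $ a\<close>, and the sign condition recovers \<open>x $ a\<close> as
  \<open>\<sigma> * \<bar>x $ a\<bar>\<close>.\<close>

lemma graph_chart_in_dom:
  assumes "\<sigma> * \<sigma> = 1" "p \<in> fst (graph_chart I a \<sigma>)"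
  shows "snd (graph_chart I a \<sigma>) p \<in> graph_dom I a"
    and "graph_param a \<sigma> (snd (graph_chart I a \<sigma>) p) = p"
proof -
  obtain s x where p: "p = (s, x)" by fastforce
  have s: "s \<in> I" and x: "x \<bullet> x = 1" and pos: "\<sigma> * x $ a > 0"
    using assms(2) by (auto simp: p graph_chart_def norm_eq_1)
  define y where "y = x + (s - x $ a) *\<^sub>R axis a 1"
  have y: "snd (graph_chart I a \<sigma>) p = y" by (simp add: p graph_chart_def y_def)
  have ya: "y $ a = s" by (simp add: y_def)
  have "y \<bullet> y = 1 + s\<^sup>2 - (x $ a)\<^sup>2"
    by (simp add: y_def inner_add_left inner_add_right inner_axis inner_axis' power2_eq_square x
        algebra_simps)
  then have r2: "1 - y \<bullet> y + (y $ a)\<^sup>2 = (x $ a)\<^sup>2" by (simp add: ya)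
  have "x $ a \<noteq> 0" using pos by auto
  then show "snd (graph_chart I a \<sigma>) p \<in> graph_dom I a" using s r2
    by (simp add: y graph_dom_def ya)
  have "\<sigma> = 1 \<or> \<sigma> = - 1" using assms(1) square_eq_1_iff by blast
  then have "\<sigma> * \<bar>x $ a\<bar> = x $ a" using pos by auto
  then have "graph_param a \<sigma> y = p"
    using r2 by (simp add: graph_param_def ya p) (simp add: y_def algebra_simps)
  then show "graph_param a \<sigma> (snd (graph_chart I a \<sigma>) p) = p" by (simp only: y)
qed

lemma graph_chart_image:
  assumes "\<sigma> * \<sigma> = 1"
  shows "chart_image (graph_chart I a \<sigma>) = graph_dom I a"
  unfolding chart_image_def
proof (intro equalityI subsetI)
  fix y
  assume "y \<in> graph_dom I a"
  from graph_param_in_chart[OF assms this]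
  show "y \<in> snd (graph_chart I a \<sigma>) ` fst (graph_chart I a \<sigma>)" by (metis imageI)
qed (use graph_chart_in_dom(1)[OF assms] in blast)

lemma graph_chart_parametrization:
  assumes "\<sigma> * \<sigma> = 1" "y \<in> graph_dom I a"
  shows "parametrization (graph_chart I a \<sigma>) y = graph_param a \<sigma> y"
proof -
  have "inj_on (snd (graph_chart I a \<sigma>)) (fst (graph_chart I a \<sigma>))"
    by (rule inj_on_inverseI[of _ "graph_param a \<sigma>"]) (rule graph_chart_in_dom(2)[OF assms(1)])
  then show ?thesis
    unfolding parametrization_def by (rule inv_into_f_eq) (rule graph_param_in_chart[OF assms])+
qed

text \<open>The differential of \<open>graph_param\<close> at \<open>y\<close>. In
  \<open>y $ a * v $ a - y \<bullet> v\<close> the time slot cancels, leaving minus the product over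
  the sphere coordinates.\<close>

definition graph_deriv :: "'m \<Rightarrow> real \<Rightarrow> real ^ 'm \<Rightarrow> real ^ 'm \<Rightarrow> real \<times> (real ^ 'm::finite)" where
  "graph_deriv a \<sigma> y v =
     (v $ a, v + (\<sigma> * ((y $ a * v $ a - y \<bullet> v) / sqrt (1 - y \<bullet> y + (y $ a)\<^sup>2)) - v $ a)
        *\<^sub>R axis a 1)"

lemma has_derivative_vec_nth: "((\<lambda>y::real^'n. y $ i) has_derivative (\<lambda>v. v $ i)) (at y)"
  by (rule bounded_linear_imp_has_derivative[OF bounded_linear_vec_nth])

lemma has_derivative_squared_height:
  fixes y :: "real^'n"
  shows "((\<lambda>y. 1 - y \<bullet> y + (y $ a)\<^sup>2) has_derivative (\<lambda>v. 2 * (y $ a * v $ a - y \<bullet> v))) (at y)"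
  by (rule has_derivative_eq_rhs, rule has_derivative_add[OF has_derivative_diff[OF
        has_derivative_const has_derivative_inner[OF has_derivative_ident has_derivative_ident]]
        has_derivative_power[OF has_derivative_vec_nth]])
    (rule ext, subst inner_commute[of _ y], simp)

lemma graph_param_has_derivative:
  assumes "y \<in> graph_dom I a"
  shows "(graph_param a \<sigma> has_derivative graph_deriv a \<sigma> y) (at y)"
proof -
  define u where "u = (\<lambda>y::real^'a. 1 - y \<bullet> y + (y $ a)\<^sup>2)"
  have pos: "0 < u y" using assms by (simp add: graph_dom_def u_def)
  have u': "(u has_derivative (\<lambda>v. 2 * (y $ a * v $ a - y \<bullet> v))) (at y)"
    unfolding u_def by (rule has_derivative_squared_height)
  have "((\<lambda>y. sqrt (u y)) has_derivative
      (\<lambda>v. 2 * (y $ a * v $ a - y \<bullet> v) * (inverse (sqrt (u y)) / 2))) (at y)"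
    by (rule DERIV_compose_FDERIV[where f = sqrt, OF DERIV_real_sqrt[OF pos] u'])
  moreover have "2 * A * (inverse s / 2) = A / s" for A s :: real by (simp add: field_simps)
  ultimately have root: "((\<lambda>y. sqrt (u y)) has_derivative
      (\<lambda>v. (y $ a * v $ a - y \<bullet> v) / sqrt (u y))) (at y)"
    by (simp only:)
  have "((\<lambda>y. (y $ a, y + (\<sigma> * sqrt (u y) - y $ a) *\<^sub>R axis a 1)) has_derivative
    (\<lambda>v. (v $ a, v + (\<sigma> * ((y $ a * v $ a - y \<bullet> v) / sqrt (u y)) - v $ a) *\<^sub>R axis a 1))) (at y)"
    by (rule has_derivative_Pair[OF has_derivative_vec_nth has_derivative_add[OF
        has_derivative_ident has_derivative_scaleR_left[OF has_derivative_diff[OF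
        has_derivative_mult_right[OF root] has_derivative_vec_nth]]]])
  then show ?thesis by (simp add: graph_param_def[abs_def] graph_deriv_def[abs_def] u_def)
qed

lemma graph_chart_parametrization_has_derivative:
  assumes "\<sigma> * \<sigma> = 1" "open I" "y \<in> graph_dom I a"
  shows "(parametrization (graph_chart I a \<sigma>) has_derivative graph_deriv a \<sigma> y) (at y)"
  by (rule has_derivative_transform_within_open[OF graph_param_has_derivative[OF assms(3)]
        open_graph_dom[OF assms(2)] assms(3)])
    (simp add: graph_chart_parametrization[OF assms(1)])

text \<open>The time component returns slot \<open>a\<close> of the vector, and the sphere component
  returns every other slot.\<close>

lemma inj_graph_deriv: "inj (graph_deriv a \<sigma> y)"
proof (rule injI)
  fix v w
  assume eq: "graph_deriv a \<sigma> y v = graph_deriv a \<sigma> y w"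
  have "v $ i = w $ i" for i
    using arg_cong[OF eq, of "\<lambda>p. snd p $ i"] arg_cong[OF eq, of fst]
    by (cases "i = a") (auto simp: graph_deriv_def axis_def)
  then show "v = w" by (simp add: vec_eq_iff)
qed

text \<open>The map is a linear one plus a root along axis \<open>a\<close>. The radicand is a
  polynomial in the coordinates, positive on the domain.\<close>

lemma ck_on_graph_param:
  fixes a :: "'m::finite"
  assumes "open I"
  shows "ck_on k (graph_dom I a) (graph_param a \<sigma>)"
proof -
  note S = open_graph_dom[OF assms, of a]
  have blc: "ck_on k (graph_dom I a) (\<lambda>y. y $ i)" for i
    by (intro ck_on_bounded_linear S bounded_linear_vec_nth)
  have inner: "ck_on k (graph_dom I a) (\<lambda>y. \<Sum>i\<in>J. y $ i * y $ i)" if "finite J" for J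
    using that by induction (auto intro!: ck_on_add ck_on_mult S blc ck_on_const)
  have neg: "ck_on k (graph_dom I a) (\<lambda>y. - h y)" if "ck_on k (graph_dom I a) h"
    for h :: "real^'m \<Rightarrow> real"
    using ck_on_bounded_linear_compose[OF S bounded_linear_minus[OF bounded_linear_ident] that] .
  have "ck_on k (graph_dom I a) (\<lambda>y. 1 + (- (\<Sum>i\<in>UNIV. y $ i * y $ i) + y $ a * y $ a))"
    by (intro ck_on_add ck_on_mult S blc ck_on_const neg inner) simp
  also have "(\<lambda>y. 1 + (- (\<Sum>i\<in>UNIV. y $ i * y $ i) + y $ a * y $ a)) =
      (\<lambda>y. 1 - y \<bullet> y + (y $ a)\<^sup>2)"
    by (simp add: fun_eq_iff inner_vec_def power2_eq_square)
  finally have "ck_on k (graph_dom I a) (\<lambda>y. sqrt (1 - y \<bullet> y + (y $ a)\<^sup>2))"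
    by (intro ck_on_sqrt S) (auto simp: graph_dom_def)
  then have root: "ck_on k (graph_dom I a)
      (\<lambda>y. (0::real, (\<sigma> * sqrt (1 - y \<bullet> y + (y $ a)\<^sup>2)) *\<^sub>R (axis a 1 :: real^'m)))"
    by (intro ck_on_bounded_linear_compose[where L = "\<lambda>t. (0, (\<sigma> * t) *\<^sub>R axis a 1)"] S)
      (auto intro!: bounded_linear_intros)
  have lin: "bounded_linear (\<lambda>y::real^'m. (y $ a, y - (y $ a) *\<^sub>R axis a 1))"
    by (auto intro!: bounded_linear_intros)
  show ?thesis
    by (rule ck_on_cong[OF S _ ck_on_add[OF S root ck_on_bounded_linear[OF S lin]]])
      (simp add: graph_param_def algebra_simps)
qed

text \<open>Makes the spacelike and stationary conditions, which quantify over
  \<open>rw_atlas\<close>, available in graph charts.\<close>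

lemma graph_chart_in_atlas:
  fixes a :: "'m::finite"
  assumes \<sigma>: "\<sigma> * \<sigma> = 1" and "open I"
  shows "graph_chart I a \<sigma> \<in> rw_atlas I"
proof -
  let ?d = "graph_chart I a \<sigma>"
  note S = open_graph_dom[OF assms(2), of a]
  have V: "fst ?d = (I \<times> sphere 0 1) \<inter> {p. \<sigma> * snd p $ a > 0}"
    by (auto simp: graph_chart_def)
  have "open {p :: real \<times> (real^'m). \<sigma> * snd p $ a > 0}"
    by (intro open_Collect_less continuous_intros)
  then have 1: "openin (rw_space I) (fst ?d)"
    unfolding V rw_space_def by (rule openin_open_Int)
  have sub: "subtopology (rw_space I) (fst ?d) = top_of_set (fst ?d)"
    unfolding rw_space_def subtopology_subtopology V by (simp add: Int_assoc[symmetric])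
  have "continuous_on (fst ?d) (snd ?d)"
    by (simp add: graph_chart_def) (intro continuous_intros)
  moreover have "continuous_on (graph_dom I a) (graph_param a \<sigma>)"
    using ck_on_graph_param[OF assms(2), of 0] by simp
  ultimately have "homeomorphic_maps (top_of_set (fst ?d)) (top_of_set (graph_dom I a))
      (snd ?d) (graph_param a \<sigma>)"
    using graph_param_in_chart[OF \<sigma>] graph_chart_in_dom[OF \<sigma>]
    by (auto simp: homeomorphic_maps_def)
  then have 2: "homeomorphic_map (subtopology (rw_space I) (fst ?d)) (top_of_set (chart_image ?d))
      (snd ?d)"
    unfolding sub graph_chart_image[OF \<sigma>] homeomorphic_map_maps by blast
  have 3: "smooth_on (chart_image ?d) (parametrization ?d)"
    unfolding graph_chart_image[OF \<sigma>] smooth_on_def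
    by (intro allI ck_on_cong[OF S _ ck_on_graph_param[OF assms(2)]])
      (simp add: graph_chart_parametrization[OF \<sigma>])
  have 4: "inj (frechet_derivative (parametrization ?d) (at y))" if "y \<in> chart_image ?d" for y
    using frechet_derivative_at[OF graph_chart_parametrization_has_derivative[OF assms]]
      inj_graph_deriv that by (metis graph_chart_image[OF \<sigma>])
  show ?thesis
    using 1 2 3 4 S by (simp add: rw_atlas_def chart_of_def graph_chart_image[OF \<sigma>])
qed

text \<open>A unit vector has a nonzero coordinate; its index and its sign determine the
  chart.\<close>

lemma graph_chart_exists:
  fixes p :: "real \<times> (real ^ 'm::finite)"
  assumes "p \<in> I \<times> sphere 0 1"
  obtains a :: 'm and \<sigma> where "\<sigma> * \<sigma> = 1" and "p \<in> fst (graph_chart I a \<sigma>)"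
proof -
  have "snd p \<noteq> 0" using assms by auto
  then obtain a where a: "snd p $ a \<noteq> 0" by (auto simp: vec_eq_iff)
  have "sgn (snd p $ a) * sgn (snd p $ a) = 1" "sgn (snd p $ a) * snd p $ a > 0"
    using a by (auto simp: sgn_if)
  then show thesis using assms by (intro that[of "sgn (snd p $ a)" a]) (auto simp: graph_chart_def)
qed

section \<open>The metric in a graph chart\<close>

lemma bilinear_rw_form: "bilinear (rw_form f s)"
  unfolding bilinear_def
  by (auto intro!: linearI simp: rw_form_def inner_add_left inner_add_right algebra_simps)

lemma rw_metric_graph_chart:
  assumes "\<sigma> * \<sigma> = 1" "open I" "y \<in> graph_dom I a"
  shows "rw_metric f (graph_chart I a \<sigma>) y =
    (\<chi> i j. rw_form f (y $ a) (graph_deriv a \<sigma> y (axis i 1)) (graph_deriv a \<sigma> y (axis j 1)))"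
  by (simp add: rw_metric_def pd_eq[OF graph_chart_parametrization_has_derivative[OF assms]]
      graph_chart_parametrization[OF assms(1,3)] graph_param_def)

lemma graph_deriv_axis_time: "graph_deriv a \<sigma> y (axis a 1) = (1, 0)"
  by (simp add: graph_deriv_def inner_axis)

text \<open>Slot \<open>a\<close> has coordinate vector \<open>(1, 0)\<close>, and the other
  coordinate vectors have no time component, so the metric splits off a block
  \<open>- 1\<close>.\<close>

lemma rw_metric_time_row:
  assumes "\<sigma> * \<sigma> = 1" "open I" "y \<in> graph_dom I a"
  shows "rw_metric f (graph_chart I a \<sigma>) y $ a $ j = (if j = a then - 1 else 0)"
  by (simp add: rw_metric_graph_chart[OF assms] graph_deriv_axis_time rw_form_def)
    (auto simp: graph_deriv_def axis_def)

text \<open>The sphere coordinate vectors are those of a graph over the unit ball. In the second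
  factor \<open>y $ a\<close> cancels, so time enters only through \<open>f\<close>.\<close>

lemma rw_metric_space_entry:
  assumes "\<sigma> * \<sigma> = 1" "open I" "y \<in> graph_dom I a" "i \<noteq> a" "j \<noteq> a"
  shows "rw_metric f (graph_chart I a \<sigma>) y $ i $ j =
    (f (y $ a))\<^sup>2 * (axis i 1 $ j + y $ i * y $ j / (1 - y \<bullet> y + (y $ a)\<^sup>2))"
proof -
  define r where "r = sqrt (1 - y \<bullet> y + (y $ a)\<^sup>2)"
  have r: "r * r = 1 - y \<bullet> y + (y $ a)\<^sup>2" using assms(3) by (simp add: r_def graph_dom_def)
  have D: "graph_deriv a \<sigma> y (axis l 1) = (0, axis l 1 - (\<sigma> * (y $ l / r)) *\<^sub>R axis a 1)"
    if "l \<noteq> a" for l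
    using that by (simp add: graph_deriv_def inner_axis r_def) (simp add: axis_def)
  have "(axis i 1 - (\<sigma> * (y $ i / r)) *\<^sub>R axis a (1::real)) \<bullet> (axis j 1 - (\<sigma> * (y $ j / r)) *\<^sub>R axis a 1)
      = axis i 1 $ j + (\<sigma> * \<sigma>) * (y $ i * y $ j / (r * r))"
    using assms(4,5) by (simp add: inner_diff_left inner_diff_right inner_axis inner_axis')
      (simp add: axis_def mult_ac)
  then show ?thesis
    using assms(1) by (simp add: rw_metric_graph_chart[OF assms(1-3)] D assms(4,5) rw_form_def r)
qed

lemma rw_metric_symmetric: "rw_metric f d y $ i $ j = rw_metric f d y $ j $ i"
  by (simp add: rw_metric_def rw_form_def inner_commute mult.commute)

lemma linear_graph_deriv:
  assumes "\<sigma> * \<sigma> = 1" "open I" "y \<in> graph_dom I a"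
  shows "linear (graph_deriv a \<sigma> y)"
  using has_derivative_linear[OF graph_chart_parametrization_has_derivative[OF assms]] .

text \<open>Pairing with the time vector kills the time component of the image of \<open>v\<close>;
  what remains has square \<open>f^2\<close> times a Euclidean norm squared, and the differential is
  injective.\<close>

lemma rw_metric_nondegenerate:
  assumes "\<sigma> * \<sigma> = 1" "open I" "y \<in> graph_dom I a" and f: "f (y $ a) \<noteq> 0"
    and v: "rw_metric f (graph_chart I a \<sigma>) y *v v = 0"
  shows "v = 0"
proof -
  let ?D = "graph_deriv a \<sigma> y"
  note form = gram_matrix_form[OF linear_graph_deriv[OF assms(1-3)] bilinear_rw_form,
      of _ f "y $ a", folded rw_metric_graph_chart[OF assms(1-3)]]
  have "rw_form f (y $ a) (?D (axis a 1)) (?D v) = 0"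
    using form[of "axis a 1" v] v by simp
  then have 1: "fst (?D v) = 0" by (simp add: graph_deriv_axis_time rw_form_def)
  have "rw_form f (y $ a) (?D v) (?D v) = 0"
    using form[of v v] v by simp
  then have "snd (?D v) = 0" using 1 f by (simp add: rw_form_def)
  then have "?D v = ?D 0"
    using 1 linear_0[OF linear_graph_deriv[OF assms(1-3)]] by (simp add: prod_eq_iff)
  then show "v = 0" using inj_graph_deriv by (rule injD[rotated])
qed

section \<open>Derivatives of the metric and Christoffel symbols with upper time index\<close>

lemma pd_rw_metric_time_row:
  assumes "\<sigma> * \<sigma> = 1" "open I" "y \<in> graph_dom I a"
  shows "pd i (\<lambda>z. rw_metric f (graph_chart I a \<sigma>) z $ a $ j) y = 0"
proof -
  have "((\<lambda>z. rw_metric f (graph_chart I a \<sigma>) z $ a $ j) has_derivative (\<lambda>_. 0)) (at y)"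
    by (rule has_derivative_transform_within_open[OF has_derivative_const
          open_graph_dom[OF assms(2)] assms(3)])
      (simp add: rw_metric_time_row[OF assms(1,2)])
  then show ?thesis by (simp add: pd_eq)
qed

text \<open>An entry is \<open>f^2\<close> times a function \<open>K\<close> constant in time, so
  its logarithmic time derivative is \<open>2 * f' / f\<close>.\<close>

lemma pd_rw_metric_time:
  assumes "\<sigma> * \<sigma> = 1" "open I" "y \<in> graph_dom I a" "b \<noteq> a" "c \<noteq> a"
    and f: "(f has_real_derivative f') (at (y $ a))" "f (y $ a) \<noteq> 0"
  shows "pd a (\<lambda>z. rw_metric f (graph_chart I a \<sigma>) z $ b $ c) y =
    2 * (f' / f (y $ a)) * rw_metric f (graph_chart I a \<sigma>) y $ b $ c"
proof -
  define u where "u = (\<lambda>z::real^'a. 1 - z \<bullet> z + (z $ a)\<^sup>2)"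
  have pos: "0 < u y" using assms(3) by (simp add: u_def graph_dom_def)
  have u': "(u has_derivative (\<lambda>v. 2 * (y $ a * v $ a - y \<bullet> v))) (at y)"
    unfolding u_def by (rule has_derivative_squared_height)
  define K where "K = (\<lambda>z::real^'a. axis b 1 $ c + z $ b * z $ c / u z)"
  obtain K' where K': "(K has_derivative K') (at y)" "K' (axis a 1) = 0"
  proof
    show "(K has_derivative (\<lambda>h. 0 + ((- (y $ b * y $ c) * (inverse (u y) * (2 * (y $ a * h $ a - y \<bullet> h)) *
          inverse (u y)) + (y $ b * h $ c + h $ b * y $ c) / u y)))) (at y)"
      unfolding K_def using pos
      by (intro has_derivative_add has_derivative_const has_derivative_divide has_derivative_mult
          has_derivative_vec_nth u') simp
  qed (use assms(4,5) in \<open>simp add: inner_axis, simp add: axis_def\<close>)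
  have "(f has_derivative (*) f') (at (y $ a))" using f(1) by (simp add: has_field_derivative_def)
  from has_derivative_compose[OF has_derivative_vec_nth this]
  have F: "((\<lambda>z. f (z $ a)) has_derivative (\<lambda>v. f' * v $ a)) (at y)" .
  have "((\<lambda>z. (f (z $ a))\<^sup>2 * K z) has_derivative
      (\<lambda>h. (f (y $ a))\<^sup>2 * K' h + (of_nat 2 * (f' * h $ a) * f (y $ a) ^ (2 - 1)) * K y)) (at y)"
    by (intro has_derivative_mult has_derivative_power F K')
  then have "((\<lambda>z. rw_metric f (graph_chart I a \<sigma>) z $ b $ c) has_derivative
      (\<lambda>h. (f (y $ a))\<^sup>2 * K' h + (of_nat 2 * (f' * h $ a) * f (y $ a) ^ (2 - 1)) * K y)) (at y)"
    by (rule has_derivative_transform_within_open[OF _ open_graph_dom[OF assms(2)] assms(3)])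
      (simp add: rw_metric_space_entry[OF assms(1,2) _ assms(4,5)] K_def u_def)
  from pd_eq[OF this, of a] show ?thesis
    using f(2) K'(2) by (simp add: rw_metric_space_entry[OF assms(1-5)] K_def u_def power2_eq_square)
qed

text \<open>Row \<open>a\<close> of the inverse metric is minus a unit vector, so only
  \<open>d = a\<close> contributes. There the derivatives of the time row vanish, and the two minus
  signs leave half the time derivative of the entry \<open>b\<close>, \<open>c\<close>.\<close>

lemma christoffel_graph_chart:
  assumes "\<sigma> * \<sigma> = 1" "open I" "y \<in> graph_dom I a" "b \<noteq> a" "c \<noteq> a"
    and f: "(f has_real_derivative f') (at (y $ a))" "f (y $ a) \<noteq> 0"
  shows "christoffel (rw_metric f (graph_chart I a \<sigma>)) y a b c =
    f' / f (y $ a) * rw_metric f (graph_chart I a \<sigma>) y $ b $ c"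
proof -
  let ?g = "rw_metric f (graph_chart I a \<sigma>)"
  have "?g y ** matrix_inv (?g y) = mat 1"
    by (rule matrix_inv_right_of_ker) (rule rw_metric_nondegenerate[OF assms(1-3), where f = f, OF f(2)])
  then have "(?g y ** matrix_inv (?g y)) $ a $ d = (if d = a then 1 else 0)" for d
    by (simp add: mat_def)
  \<comment> \<open>Since row \<open>a\<close> of the metric is \<open>- 1\<close> at
    \<open>a\<close> and zero elsewhere, row \<open>a\<close> of the product is minus row
    \<open>a\<close> of the inverse.\<close>
  then have inv: "matrix_inv (?g y) $ a $ d = (if d = a then - 1 else 0)" for d
    using rw_metric_time_row[OF assms(1-3), of f]
    by (simp add: matrix_matrix_mult_def if_distrib[of "\<lambda>t. t * _"] cong: if_cong) (smt (verit))
  show ?thesis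
    unfolding christoffel_def
    by (simp add: inv if_distrib[of "\<lambda>t. t * _"] pd_rw_metric_time_row[OF assms(1-3)]
        pd_rw_metric_time[OF assms] cong: if_cong)
qed

section \<open>Extrema of the time coordinate\<close>

text \<open>The factor \<open>s\<close> covers both cases: \<open>s\<close> times the time
  coordinate has a minimum at \<open>x\<close>, and \<open>s * f'\<close> is positive. The time
  component of the mean curvature, times \<open>s\<close>, is then a nonnegative plus a positive
  term.\<close>

lemma stationary_graph_chart_no_extremum:
  fixes f :: "real \<Rightarrow> real" and I :: "real set" and \<sigma> :: real and a :: "'m::finite"
    and \<Phi> :: "real^'k::finite \<Rightarrow> real^'m"
  defines "g \<equiv> rw_metric f (graph_chart I a \<sigma>)"
  assumes \<sigma>: "\<sigma> * \<sigma> = 1" "open I" "\<Phi> x \<in> graph_dom I a"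
    and f: "(f has_real_derivative f') (at (\<Phi> x $ a))" "0 < f (\<Phi> x $ a)"
    and S: "open S" "x \<in> S" and ck: "ck_on (Suc (Suc 0)) S \<Phi>"
    and min: "\<And>z. z \<in> S \<Longrightarrow> s * \<Phi> x $ a \<le> s * \<Phi> z $ a" and s: "s \<noteq> 0" "0 < s * f'"
    and pos: "\<And>v. v \<noteq> 0 \<Longrightarrow> 0 < v \<bullet> (induced_metric g \<Phi> x *v v)"
    and H: "mean_curvature g \<Phi> x = 0"
  shows False
proof -
  define G where "G = g (\<Phi> x)"
  define B where "B = induced_metric g \<Phi> x"
  define L where "L = frechet_derivative \<Phi> (at x)"
  have L: "linear L"
    unfolding L_def by (rule has_derivative_linear[OF ck_on_Suc_has_derivative[OF ck S(2)]])
  have Lpd: "L (axis i 1) = pd i \<Phi> x" for i by (simp add: L_def pd_def)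
  \<comment> \<open>The scaled time is linear in the graph coordinates, so its derivatives are time
    components of derivatives of \<open>\<Phi>\<close>.\<close>
  have K: "bounded_linear (\<lambda>v::real^'m. s * v $ a)"
    by (intro bounded_linear_intros bounded_linear_vec_nth)
  note ck\<phi> = ck_on_bounded_linear_compose[OF S(1) K ck]
  note crit = local_min_gradient_hessian[OF S ck\<phi> min]
  have grad: "pd i \<Phi> x $ a = 0" for i
    using crit(1)[of i] s(1) by (simp add: pd_bounded_linear_compose[OF K ck S(2)])
  define Hess where "Hess = (\<chi> i j. s * pd i (pd j \<Phi>) x $ a)"
  have Hess: "0 \<le> v \<bullet> (Hess *v v)" for v
    using crit(2)[of v] by (simp add: pd_pd_bounded_linear_compose[OF K ck S] Hess_def)
  have "transpose G = G"
    unfolding G_def g_def transpose_def vec_eq_iff by (simp add: rw_metric_symmetric)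
  then have G: "v \<bullet> (G *v w) = w \<bullet> (G *v v)" for v w
    using dot_lmul_matrix[of v G w] transpose_matrix_vector[of G v] by (simp add: inner_commute)
  have B: "p \<bullet> (B *v q) = L p \<bullet> (G *v L q)" for p q
    using gram_matrix_form[OF L bilinear_matrix] by (simp add: B_def induced_metric_def Lpd G_def)
  have Bij: "B $ i $ j = pd i \<Phi> x \<bullet> (G *v pd j \<Phi> x)" for i j
    by (simp add: B_def induced_metric_def G_def)
  have "transpose B = B" using G by (simp add: transpose_def vec_eq_iff Bij)
  note inv = matrix_inv_posdef[OF this pos[folded B_def]]
  define N where "N = matrix_inv B"
  have N: "N $ i $ j = N $ j $ i" for i j
    using inv(2) by (metis N_def transpose_def vec_lambda_beta)
  have tangent: "t $ a = 0" if "t \<in> range L" for t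
  proof -
    from that obtain u where "t = L u" by blast
    then show ?thesis by (subst (asm) linear_axis_expansion[OF L]) (simp add: Lpd grad)
  qed
  \<comment> \<open>Terms with \<open>b\<close> or \<open>c\<close> equal to \<open>a\<close> carry
    a factor from the vanishing gradient; the known Christoffel symbols handle the others.\<close>
  have christ: "(\<Sum>b\<in>UNIV. \<Sum>c\<in>UNIV. christoffel g (\<Phi> x) a b c * pd i \<Phi> x $ b * pd j \<Phi> x $ c)
      = f' / f (\<Phi> x $ a) * B $ i $ j" for i j
  proof -
    have "christoffel g (\<Phi> x) a b c * pd i \<Phi> x $ b * pd j \<Phi> x $ c =
        f' / f (\<Phi> x $ a) * (pd i \<Phi> x $ b * (G $ b $ c * pd j \<Phi> x $ c))" for b c
    proof (cases "b = a \<or> c = a")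
      case True
      then show ?thesis using grad by auto
    next
      case False
      then show ?thesis
        using christoffel_graph_chart[OF \<sigma>, of b c f f'] f by (simp add: G_def g_def)
    qed
    then show ?thesis
      by (simp add: Bij inner_vec_def matrix_vector_mult_def sum_distrib_left)
  qed
  \<comment> \<open>Passing to the normal part subtracts a tangent vector, whose time component is
    zero at the critical point.\<close>
  have II: "s * second_fundamental_form g \<Phi> i j x $ a
      = Hess $ i $ j + s * f' / f (\<Phi> x $ a) * B $ i $ j" for i j
  proof -
    have "covariant_pd g \<Phi> i j x - second_fundamental_form g \<Phi> i j x \<in> range L"
      unfolding second_fundamental_form_def L_def[symmetric] G_def[symmetric]
      using pos[folded B_def] by (intro normal_part_diff_in L G) (simp flip: B)
    from tangent[OF this] have "second_fundamental_form g \<Phi> i j x $ a = covariant_pd g \<Phi> i j x $ a"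
      by simp
    then have "second_fundamental_form g \<Phi> i j x $ a
        = pd i (pd j \<Phi>) x $ a + f' / f (\<Phi> x $ a) * B $ i $ j"
      by (simp add: covariant_pd_def christ)
    then show ?thesis by (simp add: Hess_def algebra_simps)
  qed
  have "(\<Sum>i\<in>UNIV. \<Sum>j\<in>UNIV. N $ i $ j *\<^sub>R second_fundamental_form g \<Phi> i j x) = 0"
    using H by (simp add: mean_curvature_def N_def B_def)
  then have "s * (\<Sum>i\<in>UNIV. \<Sum>j\<in>UNIV. N $ i $ j *\<^sub>R second_fundamental_form g \<Phi> i j x) $ a = 0"
    by simp
  then have "(\<Sum>i\<in>UNIV. \<Sum>j\<in>UNIV. N $ i $ j * (s * second_fundamental_form g \<Phi> i j x $ a)) = 0"
    by (simp add: sum_distrib_left mult_ac)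
  then have total: "(\<Sum>i\<in>UNIV. \<Sum>j\<in>UNIV. N $ i $ j * Hess $ i $ j)
      + s * f' / f (\<Phi> x $ a) * (\<Sum>i\<in>UNIV. \<Sum>j\<in>UNIV. N $ i $ j * B $ i $ j) = 0"
    by (simp add: II distrib_left sum.distrib sum_distrib_left mult_ac)
  \<comment> \<open>The trace of the induced metric with respect to itself is the dimension, which
    is positive.\<close>
  have trace: "(\<Sum>i\<in>UNIV. \<Sum>j\<in>UNIV. N $ i $ j * B $ i $ j) = real CARD('k)"
  proof -
    have "(\<Sum>j\<in>UNIV. N $ i $ j * B $ i $ j) = 1" for i
    proof -
      have "(\<Sum>j\<in>UNIV. N $ i $ j * B $ i $ j) = (B ** N) $ i $ i"
        by (simp add: matrix_matrix_mult_def N[of i] mult.commute)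
      then show ?thesis using inv(1) by (simp add: N_def mat_def)
    qed
    then show ?thesis by simp
  qed
  have Hess_trace: "0 \<le> (\<Sum>i\<in>UNIV. \<Sum>j\<in>UNIV. N $ i $ j * Hess $ i $ j)"
    by (rule trace_psd_mult_nonneg[OF N _ Hess]) (simp add: N_def inv(3))
  have "0 < s * f' / f (\<Phi> x $ a) * real CARD('k)"
    using s(2) f(2) by simp
  from add_nonneg_pos[OF Hess_trace this] show False
    unfolding total[unfolded trace] by simp
qed

section \<open>Charts as homeomorphisms onto open sets\<close>

lemma open_local_dom:
  assumes "chart_of X c" "openin Y (fst d)" "continuous_map X Y F"
  shows "open (local_dom c d F)"
proof -
  have "openin X (fst c)" using assms(1) by (simp add: chart_of_def)
  moreover have "openin X {p \<in> topspace X. F p \<in> fst d}"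
    using assms(2,3) by (simp add: openin_continuous_map_preimage)
  ultimately have "openin X (fst c \<inter> {p \<in> topspace X. F p \<in> fst d})" by (rule openin_Int)
  also have "fst c \<inter> {p \<in> topspace X. F p \<in> fst d} = fst c \<inter> F -` fst d"
    using openin_subset[OF \<open>openin X (fst c)\<close>] by blast
  finally have "openin X (fst c \<inter> F -` fst d)" .
  then have "openin (subtopology X (fst c)) (fst c \<inter> F -` fst d)"
    by (metis inf_le1 openin_subtopology_Int2 inf.absorb_iff2)
  moreover have "homeomorphic_map (subtopology X (fst c)) (top_of_set (chart_image c)) (snd c)"
    and "open (chart_image c)"
    using assms(1) by (auto simp: chart_of_def)
  ultimately have "openin (top_of_set (chart_image c)) (local_dom c d F)"
    unfolding local_dom_def by (meson homeomorphic_map_openness_eq)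
  then show ?thesis using \<open>open (chart_image c)\<close> openin_open_trans by blast
qed

lemma inj_on_chart:
  assumes "chart_of X c"
  shows "inj_on (snd c) (fst c)"
proof -
  have "homeomorphic_map (subtopology X (fst c)) (top_of_set (chart_image c)) (snd c)"
    and "fst c \<subseteq> topspace X"
    using assms openin_subset by (auto simp: chart_of_def)
  then show ?thesis using homeomorphic_imp_injective_map by (fastforce simp: Int_absorb1)
qed

section \<open>Extremal time on a compact submanifold\<close>

theorem corollary4p6:
  fixes I :: "real set" and f :: "real \<Rightarrow> real" and n :: nat
  assumes "CARD('m::finite) = n + 1" and "n \<ge> 1"
    and "open I" and "is_interval I" and "I \<noteq> {}"
    and "smooth_on I f" and "\<forall>s\<in>I. f s > 0"
    and "(\<forall>s\<in>I. deriv f s > 0) \<or> (\<forall>s\<in>I. deriv f s < 0)"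
    and "null_convergence (rw_atlas I :: (real \<times> (real ^ 'm), 'm) chart set) (rw_metric f)"
  shows "\<not> (\<exists>(X :: 'p topology) (A :: ('p, 'k::finite) chart set) (F :: 'p \<Rightarrow> real \<times> (real ^ 'm)).
           smooth_manifold X A \<and> topspace X \<noteq> {} \<and> compact_space X \<and>
           immersion X A (rw_space I) (rw_atlas I) F \<and>
           spacelike A (rw_atlas I) (rw_metric f) F \<and>
           stationary A (rw_atlas I) (rw_metric f) F)"
proof
  assume "\<exists>(X :: 'p topology) (A :: ('p, 'k) chart set) (F :: 'p \<Rightarrow> real \<times> (real ^ 'm)).
           smooth_manifold X A \<and> topspace X \<noteq> {} \<and> compact_space X \<and>
           immersion X A (rw_space I) (rw_atlas I) F \<and>
           spacelike A (rw_atlas I) (rw_metric f) F \<and>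
           stationary A (rw_atlas I) (rw_metric f) F"
  then obtain X :: "'p topology" and A :: "('p, 'k) chart set" and F :: "'p \<Rightarrow> real \<times> (real ^ 'm)"
    where X: "smooth_manifold X A" "topspace X \<noteq> {}" "compact_space X"
      and imm: "immersion X A (rw_space I) (rw_atlas I) F"
      and space: "spacelike A (rw_atlas I) (rw_metric f) F"
      and stat: "stationary A (rw_atlas I) (rw_metric f) F"
    by blast
  \<comment> \<open>The sign is \<open>1\<close> when expanding and \<open>- 1\<close> when
    contracting, so minimizing \<open>s\<close> times the time picks its minimum or maximum
    respectively.\<close>
  obtain s :: real where s: "s \<noteq> 0" "\<And>t. t \<in> I \<Longrightarrow> 0 < s * deriv f t"
    using assms(8)
  proof
    assume "\<forall>t\<in>I. deriv f t > 0"
    then show thesis by (intro that[of 1]) auto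
  next
    assume "\<forall>t\<in>I. deriv f t < 0"
    then show thesis by (intro that[of "- 1"]) auto
  qed
  have contF: "continuous_map X (rw_space I) F" using imm by (simp add: immersion_def smooth_map_def)
  then have F_in: "F q \<in> I \<times> sphere 0 1" if "q \<in> topspace X" for q
    using that by (fastforce simp: continuous_map_def rw_space_def Pi_iff)
  have "continuous_map X euclidean F"
    using contF by (simp add: rw_space_def continuous_map_in_subtopology)
  then have "continuous_map X euclideanreal (\<lambda>q. s * fst (F q))"
    using continuous_map_compose[of X euclidean F euclidean "\<lambda>p. s * fst p"]
    by (simp add: o_def continuous_on_mult continuous_on_fst)
  moreover have "compactin X (topspace X)" using X(3) by (simp add: compact_space_def)
  ultimately have "compact ((\<lambda>q. s * fst (F q)) ` topspace X)"
    using image_compactin by fastforce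
  then obtain p where p: "p \<in> topspace X"
    and p_min: "\<And>q. q \<in> topspace X \<Longrightarrow> s * fst (F p) \<le> s * fst (F q)"
    using compact_attains_inf[of "(\<lambda>q. s * fst (F q)) ` topspace X"] X(2) by auto
  obtain c where c: "c \<in> A" "p \<in> fst c"
    using X(1) p unfolding smooth_manifold_def smooth_atlas_def by blast
  have chart: "chart_of X c" using X(1) c(1) by (auto simp: smooth_manifold_def smooth_atlas_def)
  have c_sub: "fst c \<subseteq> topspace X"
    using chart by (intro openin_subset) (simp add: chart_of_def)
  obtain a :: 'm and \<sigma> where \<sigma>: "\<sigma> * \<sigma> = 1" and Fp: "F p \<in> fst (graph_chart I a \<sigma>)"
    by (rule graph_chart_exists[OF F_in[OF p]])
  define d where "d = graph_chart I a \<sigma>"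
  \<comment> \<open>Near \<open>F p\<close> the graph chart makes time the coordinate
    \<open>a\<close>, as the local lemma requires.\<close>
  have d: "d \<in> rw_atlas I" unfolding d_def by (rule graph_chart_in_atlas[OF \<sigma> assms(3)])
  define S where "S = local_dom c d F"
  define \<Phi> where "\<Phi> = local_rep c d F"
  define x where "x = snd c p"
  have x: "x \<in> S" using c(2) Fp by (auto simp: S_def local_dom_def x_def d_def)
  have S: "open S"
    unfolding S_def using d contF by (intro open_local_dom[OF chart]) (auto simp: rw_atlas_def chart_of_def)
  have \<Phi>_at: "\<Phi> (snd c q) = snd d (F q)" if "q \<in> fst c" for q
    using that inj_on_chart[OF chart] by (simp add: \<Phi>_def local_rep_def parametrization_def)
  have time: "snd d r $ a = fst r" for r by (simp add: d_def graph_chart_def)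
  have \<Phi>x: "\<Phi> x $ a = fst (F p)" "\<Phi> x \<in> graph_dom I a"
    using graph_chart_in_dom(1)[OF \<sigma> Fp] by (simp_all add: x_def \<Phi>_at[OF c(2)] time) (simp add: d_def)
  have ck: "ck_on (Suc (Suc 0)) S \<Phi>"
    using imm c(1) d unfolding S_def \<Phi>_def immersion_def smooth_map_def smooth_on_def by blast
  \<comment> \<open>The global minimality of \<open>p\<close> transfers to the whole coordinate
    domain, because slot \<open>a\<close> of the chart is the time itself.\<close>
  have min: "s * \<Phi> x $ a \<le> s * \<Phi> z $ a" if z: "z \<in> S" for z
  proof -
    obtain q where q: "q \<in> fst c" "z = snd c q" using z by (auto simp: S_def local_dom_def)
    then show ?thesis using p_min[of q] c_sub by (auto simp: \<Phi>x(1) \<Phi>_at time)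
  qed
  have "\<Phi> x $ a \<in> I" using \<Phi>x(2) by (simp add: graph_dom_def)
  have "f differentiable (at (\<Phi> x $ a))"
    using assms(6) \<open>\<Phi> x $ a \<in> I\<close> unfolding smooth_on_def by (metis ck_on.simps(2))
  then have f': "(f has_real_derivative deriv f (\<Phi> x $ a)) (at (\<Phi> x $ a))"
    by (simp add: DERIV_deriv_iff_real_differentiable)
  have pos: "0 < v \<bullet> (induced_metric (rw_metric f d) \<Phi> x *v v)" if "v \<noteq> 0" for v
    using space c(1) d x that by (auto simp: spacelike_def S_def \<Phi>_def)
  have H: "mean_curvature (rw_metric f d) \<Phi> x = 0"
    using stat c(1) d x by (auto simp: stationary_def S_def \<Phi>_def)
  have f_pos: "0 < f (\<Phi> x $ a)" and sf': "0 < s * deriv f (\<Phi> x $ a)"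
    using \<open>\<Phi> x $ a \<in> I\<close> assms(7) s(2) by auto
  show False
    by (rule stationary_graph_chart_no_extremum[OF \<sigma> assms(3) \<Phi>x(2) f' f_pos S x ck min s(1) sf'
          pos[unfolded d_def] H[unfolded d_def]])
qed

end
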